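(* Let $\Delta_1,\Delta_2$ be integers with $\Delta_2>\Delta_1\geq 1$ and let $\mathcal G$ be any temporal graph with vertex set $V(\mathcal G)$. (i) If $\Delta_1=1$, then $\mathcal G$ is a $(1,\Delta_2)$-cluster temporal graph if and only if $\mathcal G[S]$ is a $(1,\Delta_2)$-cluster temporal graph for every set $S\subseteq V(\mathcal G)$ of at most $3$ vertices. (ii) If $\Delta_1>1$, then $\mathcal G$ is a $(\Delta_1,\Delta_2)$-cluster temporal graph if and only if $\mathcal G[S]$ is a $(\Delta_1,\Delta_2)$-cluster temporal graph for every set $S\subseteq V(\mathcal G)$ of at most $5$ vertices.
   Context: A temporal graph $\mathcal G=(G,\mathcal T)$ consists of a finite static undirected graph $G=(V,E)$ and a function $\mathcal T:E\to 2^{\mathbb Z^+}\setminus\{\emptyset\}$ (finite sets) giving the times at which each edge appears; its time-edges are $\mathcal E(\mathcal G)=\{(e,t):e\in E,\ t\in\mathcal T(e)\}$ and its lifetime is $T(\mathcal G)=\max\{t:(e,t)\in\mathcal E(\mathcal G)\}$. An interval $[a,b]$ means the integer set $\{a,a+1,\dots,b\}$. For $\Delta_1\in\mathbb Z^+$, an edge $e$ is $\Delta_1$-dense in $[a,b]$ if for every $\tau\in[a,\max\{a,b-\Delta_1+1\}]$ there is $t\in\mathcal T(e)$ with $\tau\le t\le \tau+\Delta_1-1$. A template is a pair $(X,[a,b])$ with $X$ a vertex set and $[a,b]$ an interval. For $\Delta_2\in\mathbb Z^+$, templates $(X,[a,b])$ and $(Y,[c,d])$ are $\Delta_2$-independent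 if $X\cap Y=\emptyset$ or $|s-t|\ge\Delta_2$ for all $s\in[a,b]$, $t\in[c,d]$. $\mathcal G$ realises a collection $\{(X_i,[a_i,b_i])\}_{i}$ of pairwise $\Delta_2$-independent templates with $1\le a_i\le b_i\le T(\mathcal G)$ if (1) for every time-edge $(xy,t)$ there is $i$ with $x,y\in X_i$ and $t\in[a_i,b_i]$, and (2) for every $i$ and distinct $x,y\in X_i$, $xy$ is an edge that is $\Delta_1$-dense in $[a_i,b_i]$. $\mathcal G$ is a $(\Delta_1,\Delta_2)$-cluster temporal graph if it realises some such collection. For $A\subseteq V$, $\mathcal G[A]$ is the temporal graph with vertex set $A$ whose time-edges are those of $\mathcal G$ with both endpoints in $A$. *)

theory Defs
  imports Main
begin

record 'a temporal_graph =
  verts :: "'a set"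
  edges :: "'a set set"
  times :: "'a set \<Rightarrow> int set"

text \<open>Static graphs are finite and simple: edges are two-element sets of vertices.
  The value of \<^term>\<open>times G\<close> outside \<^term>\<open>edges G\<close> is irrelevant.\<close>

definition temporal_graph :: "'a temporal_graph \<Rightarrow> bool" where
  "temporal_graph G \<longleftrightarrow>
     finite (verts G) \<and>
     (\<forall>e\<in>edges G. e \<subseteq> verts G \<and> card e = 2) \<and>
     (\<forall>e\<in>edges G. finite (times G e) \<and> times G e \<noteq> {} \<and> times G e \<subseteq> {1..})"

definition time_edges :: "'a temporal_graph \<Rightarrow> ('a set \<times> int) set" where
  "time_edges G = {(e, t). e \<in> edges G \<and> t \<in> times G e}"

text \<open>A temporal graph without time-edges gets lifetime 0. It then admits no template with
  \<open>1 \<le> a \<le> b \<le> lifetime G\<close>, and it realises the empty collection.\<close>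

definition lifetime :: "'a temporal_graph \<Rightarrow> int" where
  "lifetime G = (if time_edges G = {} then 0 else Max (snd ` time_edges G))"

definition induced :: "'a temporal_graph \<Rightarrow> 'a set \<Rightarrow> 'a temporal_graph" where
  "induced G A = \<lparr>verts = A, edges = {e \<in> edges G. e \<subseteq> A}, times = times G\<rparr>"

definition dense :: "int \<Rightarrow> 'a temporal_graph \<Rightarrow> 'a set \<Rightarrow> int \<Rightarrow> int \<Rightarrow> bool" where
  "dense \<Delta>1 G e a b \<longleftrightarrow>
     (\<forall>\<tau>\<in>{a..max a (b - \<Delta>1 + 1)}. \<exists>t\<in>times G e. \<tau> \<le> t \<and> t \<le> \<tau> + \<Delta>1 - 1)"

text \<open>The triple \<open>(X, a, b)\<close> stands for the template \<open>(X, [a, b])\<close>.\<close>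

type_synonym 'a template = "'a set \<times> int \<times> int"

definition independent :: "int \<Rightarrow> 'a template \<Rightarrow> 'a template \<Rightarrow> bool" where
  "independent \<Delta>2 = (\<lambda>(X, a, b) (Y, c, d).
     X \<inter> Y = {} \<or> (\<forall>s\<in>{a..b}. \<forall>t\<in>{c..d}. \<bar>s - t\<bar> \<ge> \<Delta>2))"

text \<open>Collections are sets of templates rather than indexed families. This loses nothing:
  for \<open>\<Delta>2 \<ge> 1\<close> a template with nonempty vertex set and nonempty interval is not independent
  of itself, so it cannot occur twice in a pairwise independent family, and repeating a template
  with empty vertex set has no effect.\<close>

definition realises ::
  "int \<Rightarrow> int \<Rightarrow> 'a temporal_graph \<Rightarrow> 'a template set \<Rightarrow> bool" where
  "realises \<Delta>1 \<Delta>2 G \<C> \<longleftrightarrow>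
     (\<forall>(X, a, b)\<in>\<C>. X \<subseteq> verts G \<and> 1 \<le> a \<and> a \<le> b \<and> b \<le> lifetime G) \<and>
     pairwise (independent \<Delta>2) \<C> \<and>
     (\<forall>(e, t)\<in>time_edges G. \<exists>(X, a, b)\<in>\<C>. e \<subseteq> X \<and> t \<in> {a..b}) \<and>
     (\<forall>(X, a, b)\<in>\<C>. \<forall>x\<in>X. \<forall>y\<in>X. x \<noteq> y \<longrightarrow>
        {x, y} \<in> edges G \<and> dense \<Delta>1 G {x, y} a b)"

definition cluster_temporal_graph :: "int \<Rightarrow> int \<Rightarrow> 'a temporal_graph \<Rightarrow> bool" where
  "cluster_temporal_graph \<Delta>1 \<Delta>2 G \<longleftrightarrow> (\<exists>\<C>. realises \<Delta>1 \<Delta>2 G \<C>)"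

end

theory Submission
  imports Defs
begin

text \<open>Call two time-edges linked if they share a vertex and are less than \<open>\<Delta>2\<close> apart. Linked
  time-edges must lie in the same template, and the time-edges within a template are connected
  by links, so the templates can only be the classes of the generated equivalence relation.
  If all small induced subgraphs are cluster graphs, then an induction along a chain of links
  shows that two equivalent time-edges \<open>(e, t)\<close>, \<open>(f, s)\<close> are already equivalent inside \<open>e \<union> f\<close>: a
  step replaces \<open>f\<close> by some \<open>g\<close> meeting it and takes place inside \<open>e \<union> f \<union> g\<close>, which has at most five
  vertices. Hence any two vertices of a class are joined by an edge of the class, which has a
  time near every time-edge of the class. For \<open>\<Delta>1 = 1\<close>, dense means present throughout, and
  three vertices suffice to see that edges that meet and are close in time have the same
  maximal run of consecutive times, so that having a common run is transitive.\<close>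

section \<open>Realisations without bounds on the intervals\<close>

text \<open>Realisation without the bounds \<open>1 \<le> a \<le> b \<le> lifetime G\<close>: they can be restored by shrinking
  each interval to the span of the times used by its template. This makes passing to induced
  subgraphs, which may have a smaller lifetime, immediate.\<close>

definition pre_realises ::
  "int \<Rightarrow> int \<Rightarrow> 'a temporal_graph \<Rightarrow> 'a template set \<Rightarrow> bool" where
  "pre_realises \<Delta>1 \<Delta>2 G \<C> \<longleftrightarrow>
     (\<forall>X a b Y c d v s t. (X, a, b) \<in> \<C> \<longrightarrow> (Y, c, d) \<in> \<C> \<longrightarrow> v \<in> X \<longrightarrow> v \<in> Y \<longrightarrow>
        a \<le> s \<longrightarrow> s \<le> b \<longrightarrow> c \<le> t \<longrightarrow> t \<le> d \<longrightarrow> \<bar>s - t\<bar> < \<Delta>2 \<longrightarrow> X = Y \<and> a = c \<and> b = d) \<and>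
     (\<forall>e t. (e, t) \<in> time_edges G \<longrightarrow> (\<exists>X a b. (X, a, b) \<in> \<C> \<and> e \<subseteq> X \<and> a \<le> t \<and> t \<le> b)) \<and>
     (\<forall>X a b x y. (X, a, b) \<in> \<C> \<longrightarrow> x \<in> X \<longrightarrow> y \<in> X \<longrightarrow> x \<noteq> y \<longrightarrow>
        {x, y} \<in> edges G \<and> dense \<Delta>1 G {x, y} a b)"

definition link :: "int \<Rightarrow> 'a temporal_graph \<Rightarrow> (('a set \<times> int) \<times> ('a set \<times> int)) set" where
  "link \<Delta>2 G = {((e, t), (f, s)). (e, t) \<in> time_edges G \<and> (f, s) \<in> time_edges G \<and>
     e \<inter> f \<noteq> {} \<and> \<bar>t - s\<bar> < \<Delta>2}"

text \<open>Contrapositive form of independence: it identifies templates that share a vertex and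
  have times less than \<open>\<Delta>2\<close> apart, which is how all later arguments apply
  it.\<close>

lemma pairwise_independent_iff:
  "pairwise (independent \<Delta>2) \<C> \<longleftrightarrow>
     (\<forall>X a b Y c d v s t. (X, a, b) \<in> \<C> \<longrightarrow> (Y, c, d) \<in> \<C> \<longrightarrow> v \<in> X \<longrightarrow> v \<in> Y \<longrightarrow>
        a \<le> s \<longrightarrow> s \<le> b \<longrightarrow> c \<le> t \<longrightarrow> t \<le> d \<longrightarrow> \<bar>s - t\<bar> < \<Delta>2 \<longrightarrow> X = Y \<and> a = c \<and> b = d)"
  (is "?L \<longleftrightarrow> ?R")
proof
  assume L: ?L
  show ?R
  proof (intro allI impI)
    fix X a b Y c d v s t
    assume XY: "(X, a, b) \<in> \<C>" "(Y, c, d) \<in> \<C>"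
      and *: "v \<in> X" "v \<in> Y" "a \<le> s" "s \<le> b" "c \<le> t" "t \<le> d" "\<bar>s - t\<bar> < \<Delta>2"
    have "\<not> independent \<Delta>2 (X, a, b) (Y, c, d)"
    proof
      assume "independent \<Delta>2 (X, a, b) (Y, c, d)"
      then have "\<Delta>2 \<le> \<bar>s - t\<bar>" using *(1-6) unfolding independent_def by auto
      then show False using *(7) by simp
    qed
    then have "(X, a, b) = (Y, c, d)" using pairwiseD[OF L XY] by blast
    then show "X = Y \<and> a = c \<and> b = d" by simp
  qed
next
  assume R: ?R
  show ?L
  proof (rule pairwiseI)
    fix p q assume pq: "p \<in> \<C>" "q \<in> \<C>" "p \<noteq> q"
    obtain X a b Y c d where [simp]: "p = (X, a, b)" "q = (Y, c, d)" by (metis prod_cases3)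
    have "\<Delta>2 \<le> \<bar>s - t\<bar>" if "v \<in> X" "v \<in> Y" "s \<in> {a..b}" "t \<in> {c..d}" for v s t
    proof (rule ccontr)
      assume "\<not> \<Delta>2 \<le> \<bar>s - t\<bar>"
      then have "X = Y \<and> a = c \<and> b = d"
        using R[rule_format, of X a b Y c d v s t] pq that by simp
      then show False using pq by simp
    qed
    then show "independent \<Delta>2 p q" unfolding independent_def by auto
  qed
qed

lemma realises_iff_pre_realises:
  "realises \<Delta>1 \<Delta>2 G \<C> \<longleftrightarrow> pre_realises \<Delta>1 \<Delta>2 G \<C> \<and>
     (\<forall>X a b. (X, a, b) \<in> \<C> \<longrightarrow> X \<subseteq> verts G \<and> 1 \<le> a \<and> a \<le> b \<and> b \<le> lifetime G)"
proof -
  have 1: "(\<forall>(X, a, b)\<in>\<C>. X \<subseteq> verts G \<and> 1 \<le> a \<and> a \<le> b \<and> b \<le> lifetime G) \<longleftrightarrow>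
      (\<forall>X a b. (X, a, b) \<in> \<C> \<longrightarrow> X \<subseteq> verts G \<and> 1 \<le> a \<and> a \<le> b \<and> b \<le> lifetime G)"
    by (simp add: Ball_def split_paired_All)
  have 2: "(\<forall>(e, t)\<in>time_edges G. \<exists>(X, a, b)\<in>\<C>. e \<subseteq> X \<and> t \<in> {a..b}) \<longleftrightarrow>
      (\<forall>e t. (e, t) \<in> time_edges G \<longrightarrow> (\<exists>X a b. (X, a, b) \<in> \<C> \<and> e \<subseteq> X \<and> a \<le> t \<and> t \<le> b))"
    by (simp add: Ball_def Bex_def split_paired_All split_paired_Ex)
  have 3: "(\<forall>(X, a, b)\<in>\<C>. \<forall>x\<in>X. \<forall>y\<in>X. x \<noteq> y \<longrightarrow> {x, y} \<in> edges G \<and> dense \<Delta>1 G {x, y} a b) \<longleftrightarrow>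
      (\<forall>X a b x y. (X, a, b) \<in> \<C> \<longrightarrow> x \<in> X \<longrightarrow> y \<in> X \<longrightarrow> x \<noteq> y \<longrightarrow>
        {x, y} \<in> edges G \<and> dense \<Delta>1 G {x, y} a b)"
    by (simp only: Ball_def split_paired_All prod.case) blast
  show ?thesis
    unfolding realises_def pre_realises_def pairwise_independent_iff 1 2 3 by (rule iffI; elim conjE; intro conjI)
qed

lemma pre_realisesI:
  assumes "\<And>X a b Y c d v s t. (X, a, b) \<in> \<C> \<Longrightarrow> (Y, c, d) \<in> \<C> \<Longrightarrow> v \<in> X \<Longrightarrow> v \<in> Y \<Longrightarrow>
      a \<le> s \<Longrightarrow> s \<le> b \<Longrightarrow> c \<le> t \<Longrightarrow> t \<le> d \<Longrightarrow> \<bar>s - t\<bar> < \<Delta>2 \<Longrightarrow> X = Y \<and> a = c \<and> b = d"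
    and "\<And>e t. (e, t) \<in> time_edges G \<Longrightarrow> \<exists>X a b. (X, a, b) \<in> \<C> \<and> e \<subseteq> X \<and> a \<le> t \<and> t \<le> b"
    and "\<And>X a b x y. (X, a, b) \<in> \<C> \<Longrightarrow> x \<in> X \<Longrightarrow> y \<in> X \<Longrightarrow> x \<noteq> y \<Longrightarrow>
      {x, y} \<in> edges G \<and> dense \<Delta>1 G {x, y} a b"
  shows "pre_realises \<Delta>1 \<Delta>2 G \<C>"
  unfolding pre_realises_def by (intro conjI allI impI; (rule assms; assumption)?) (metis assms)+

lemma pre_realises_cover:
  assumes "pre_realises \<Delta>1 \<Delta>2 G \<C>" "(e, t) \<in> time_edges G"
  obtains X a b where "(X, a, b) \<in> \<C>" "e \<subseteq> X" "a \<le> t" "t \<le> b"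
  using assms unfolding pre_realises_def by metis

lemma pre_realises_clique:
  assumes "pre_realises \<Delta>1 \<Delta>2 G \<C>" "(X, a, b) \<in> \<C>" "x \<in> X" "y \<in> X" "x \<noteq> y"
  shows "{x, y} \<in> edges G" "dense \<Delta>1 G {x, y} a b"
  using assms unfolding pre_realises_def by metis+

lemma pre_realises_unique:
  assumes "pre_realises \<Delta>1 \<Delta>2 G \<C>" "(X, a, b) \<in> \<C>" "(Y, c, d) \<in> \<C>"
    and "v \<in> X" "v \<in> Y" "a \<le> s" "s \<le> b" "c \<le> t" "t \<le> d" "\<bar>s - t\<bar> < \<Delta>2"
  shows "X = Y" "a = c" "b = d"
proof -
  have "X = Y \<and> a = c \<and> b = d"
    using assms(1)[unfolded pre_realises_def, THEN conjunct1, rule_format, OF assms(2-)] .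
  then show "X = Y" "a = c" "b = d" by auto
qed

section \<open>Time-edges, induced subgraphs and chains of links\<close>

lemma time_edges_induced: "time_edges (induced G A) = {(e, t) \<in> time_edges G. e \<subseteq> A}"
  by (auto simp: time_edges_def induced_def)

lemma induced_induced: "B \<subseteq> A \<Longrightarrow> induced (induced G A) B = induced G B"
  by (auto simp: induced_def)

lemma temporal_graph_induced:
  "temporal_graph G \<Longrightarrow> A \<subseteq> verts G \<Longrightarrow> temporal_graph (induced G A)"
  by (auto simp: temporal_graph_def induced_def intro: finite_subset)

lemma dense_induced [simp]: "dense \<Delta>1 (induced G A) = dense \<Delta>1 G"
  by (auto simp: dense_def induced_def fun_eq_iff)

lemma edges_induced [simp]: "e \<in> edges (induced G A) \<longleftrightarrow> e \<in> edges G \<and> e \<subseteq> A"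
  by (auto simp: induced_def)

lemma time_edgeD:
  assumes "temporal_graph G" "(e, t) \<in> time_edges G"
  shows "e \<in> edges G" "t \<in> times G e" "1 \<le> t" "e \<subseteq> verts G" "card e = 2"
  using assms by (auto simp: temporal_graph_def time_edges_def)

lemma finite_time_edges:
  assumes "temporal_graph G"
  shows "finite (time_edges G)"
proof -
  have "edges G \<subseteq> Pow (verts G)" "finite (verts G)"
    using assms by (auto simp: temporal_graph_def)
  then have "finite (edges G)" by (meson finite_Pow_iff finite_subset)
  moreover have "time_edges G = Sigma (edges G) (times G)"
    by (auto simp: time_edges_def)
  ultimately show ?thesis using assms by (auto simp: temporal_graph_def)
qed

lemma le_lifetime:
  assumes "temporal_graph G" "(e, t) \<in> time_edges G"
  shows "t \<le> lifetime G"
proof -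
  have "t \<in> snd ` time_edges G" using assms(2) by force
  then have "t \<le> Max (snd ` time_edges G)" using finite_time_edges[OF assms(1)] by simp
  then show ?thesis using assms(2) by (auto simp: lifetime_def)
qed

lemma link_rtrancl_sym:
  assumes "(p, q) \<in> (link \<Delta>2 G)\<^sup>*"
  shows "(q, p) \<in> (link \<Delta>2 G)\<^sup>*"
proof -
  have "sym (link \<Delta>2 G)" unfolding link_def by (auto simp: sym_def)
  from symD[OF sym_rtrancl[OF this] assms] show ?thesis .
qed

lemma link_mono: "A \<subseteq> B \<Longrightarrow> link \<Delta>2 (induced G A) \<subseteq> link \<Delta>2 (induced G B)"
  by (auto simp: link_def time_edges_induced)

lemma link_induced_le: "link \<Delta>2 (induced G A) \<subseteq> link \<Delta>2 G"
  by (auto simp: link_def time_edges_induced)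

lemma link_rtrancl_time_edge:
  assumes "(p, q) \<in> (link \<Delta>2 G)\<^sup>*" "p \<in> time_edges G"
  shows "q \<in> time_edges G"
  using assms by (induction rule: rtrancl_induct) (auto simp: link_def)

text \<open>Along each link, the template covering the next time-edge shares a vertex with the
  current template and has a time less than \<open>\<Delta>2\<close> away from one of its times, so
  independence makes it the same template.\<close>

lemma link_rtrancl_same_template:
  assumes "pre_realises \<Delta>1 \<Delta>2 G \<C>" "(X, a, b) \<in> \<C>"
    and "((e, t), (f, s)) \<in> (link \<Delta>2 G)\<^sup>*" "e \<subseteq> X" "a \<le> t" "t \<le> b"
  shows "f \<subseteq> X \<and> a \<le> s \<and> s \<le> b"
  using assms(3)
proof (induction "f" "s" rule: rtrancl_induct2)
  case refl
  then show ?case using assms by simp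
next
  case (step f s g r)
  obtain v where v: "v \<in> f" "v \<in> g" and d: "\<bar>s - r\<bar> < \<Delta>2" and "(g, r) \<in> time_edges G"
    using step.hyps(2) by (auto simp: link_def)
  then obtain Y c d where "(Y, c, d) \<in> \<C>" "g \<subseteq> Y" "c \<le> r" "r \<le> d"
    using pre_realises_cover[OF assms(1)] by metis
  then show ?case
    using pre_realises_unique[OF assms(1,2), of Y c d v s r] step.IH v d by blast
qed

text \<open>Cutting every vertex set down to \<open>S\<close> suffices, since density depends only
  on the times of an edge. The intervals stay as they are, although the lifetime of
  \<open>induced G S\<close> may be smaller.\<close>

lemma pre_realises_induced:
  assumes "pre_realises \<Delta>1 \<Delta>2 G \<C>"
  shows "pre_realises \<Delta>1 \<Delta>2 (induced G S) ((\<lambda>(X, a, b). (X \<inter> S, a, b)) ` \<C>)"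
proof (rule pre_realisesI)
  fix X a b Y c d v s t
  assume "(X, a, b) \<in> (\<lambda>(X, a, b). (X \<inter> S, a, b)) ` \<C>" "(Y, c, d) \<in> (\<lambda>(X, a, b). (X \<inter> S, a, b)) ` \<C>"
    and *: "v \<in> X" "v \<in> Y" "a \<le> s" "s \<le> b" "c \<le> t" "t \<le> d" "\<bar>s - t\<bar> < \<Delta>2"
  then obtain X' Y' where "X = X' \<inter> S" "Y = Y' \<inter> S" "(X', a, b) \<in> \<C>" "(Y', c, d) \<in> \<C>" by auto
  then show "X = Y \<and> a = c \<and> b = d"
    using * pre_realises_unique[OF assms, of X' a b Y' c d v s t] by blast
next
  fix e t assume "(e, t) \<in> time_edges (induced G S)"
  then have "(e, t) \<in> time_edges G" "e \<subseteq> S" by (auto simp: time_edges_induced)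
  then obtain X a b where "(X, a, b) \<in> \<C>" "e \<subseteq> X" "a \<le> t" "t \<le> b"
    using pre_realises_cover[OF assms] by metis
  then show "\<exists>X a b. (X, a, b) \<in> (\<lambda>(X, a, b). (X \<inter> S, a, b)) ` \<C> \<and> e \<subseteq> X \<and> a \<le> t \<and> t \<le> b"
    using \<open>e \<subseteq> S\<close> by (intro exI[of _ "X \<inter> S"] exI[of _ a] exI[of _ b]) force
next
  fix X a b x y
  assume "(X, a, b) \<in> (\<lambda>(X, a, b). (X \<inter> S, a, b)) ` \<C>" "x \<in> X" "y \<in> X" "x \<noteq> y"
  then obtain X' where "X = X' \<inter> S" "(X', a, b) \<in> \<C>" "x \<in> X'" "y \<in> X'" "x \<in> S" "y \<in> S" by auto
  then show "{x, y} \<in> edges (induced G S) \<and> dense \<Delta>1 (induced G S) {x, y} a b"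
    using pre_realises_clique[OF assms, of X' a b x y] \<open>x \<noteq> y\<close> by simp
qed

section \<open>Restoring the bounds, and heredity under induced subgraphs\<close>

locale density_bounds =
  fixes \<Delta>1 \<Delta>2 :: int
  assumes \<Delta>1_ge: "\<Delta>1 \<ge> 1" and \<Delta>2_gt: "\<Delta>2 > \<Delta>1"
begin

text \<open>For intervals shorter than \<open>\<Delta>1\<close>, \<^const>\<open>dense\<close> alone only provides a time possibly
  beyond \<open>b\<close>; such a time would belong to a template not independent of the given one.\<close>

lemma time_near:
  assumes re: "pre_realises \<Delta>1 \<Delta>2 G \<C>" and X: "(X, a, b) \<in> \<C>" "x \<in> X" "y \<in> X" "x \<noteq> y"
    and s: "a \<le> s" "s \<le> b"
  obtains t where "({x, y}, t) \<in> time_edges G" "a \<le> t" "t \<le> b" "\<bar>t - s\<bar> < \<Delta>1"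
proof -
  \<comment> \<open>\<open>\<tau>\<close> is \<open>s\<close> clamped to the admissible window
    starts. The window of length \<open>\<Delta>1\<close> starting there contains \<open>s\<close>
    in every case, and it can reach beyond \<open>b\<close> only if
    \<open>\<tau> = a\<close>.\<close>
  define \<tau> where "\<tau> = max a (min s (b - \<Delta>1 + 1))"
  have "\<tau> \<in> {a..max a (b - \<Delta>1 + 1)}" unfolding \<tau>_def by auto
  then obtain t where t: "t \<in> times G {x, y}" "\<tau> \<le> t" "t \<le> \<tau> + \<Delta>1 - 1"
    using pre_realises_clique(2)[OF re X] unfolding dense_def by blast
  have te: "({x, y}, t) \<in> time_edges G"
    using t pre_realises_clique(1)[OF re X] by (auto simp: time_edges_def)
  have "t \<le> b"
  proof (rule ccontr)
    assume "\<not> t \<le> b"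
    then have "\<tau> = a" using t(3) unfolding \<tau>_def by linarith
    obtain Y c d where "(Y, c, d) \<in> \<C>" "{x, y} \<subseteq> Y" "c \<le> t" "t \<le> d"
      using pre_realises_cover[OF re te] by metis
    then have "b = d"
      using pre_realises_unique(3)[OF re X(1), of Y c d x a t] X(2) s t \<open>\<tau> = a\<close> \<Delta>2_gt by auto
    then show False using \<open>t \<le> d\<close> \<open>\<not> t \<le> b\<close> by simp
  qed
  moreover have "\<bar>t - s\<bar> < \<Delta>1" "a \<le> t" using t s \<Delta>1_ge unfolding \<tau>_def by linarith+
  ultimately show thesis using that te by blast
qed

text \<open>After shrinking, both ends of an interval are times of actual time-edges and hence lie
  between 1 and the lifetime. Templates with fewer than two vertices or with an empty interval are
  dropped; they cover no time-edge.\<close>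

lemma pre_realises_imp_cluster:
  assumes G: "temporal_graph G" and re: "pre_realises \<Delta>1 \<Delta>2 G \<C>"
  shows "cluster_temporal_graph \<Delta>1 \<Delta>2 G"
proof -
  define T where "T X a b = {t \<in> {a..b}. \<exists>x\<in>X. \<exists>y\<in>X. x \<noteq> y \<and> ({x, y}, t) \<in> time_edges G}"
    for X :: "'a set" and a b
  \<comment> \<open>Two distinct vertices and \<open>a \<le> b\<close> make \<open>T X a b\<close>
    nonempty by \<open>time_near\<close>, so that \<open>Min\<close> and \<open>Max\<close> are
    genuine elements of it.\<close>
  define \<D> where "\<D> = {(X, Min (T X a b), Max (T X a b)) | X a b.
      (X, a, b) \<in> \<C> \<and> a \<le> b \<and> (\<exists>x\<in>X. \<exists>y\<in>X. x \<noteq> y)}"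
  have fin: "finite (T X a b)" for X a b
    by (rule finite_subset[of _ "{a..b}"]) (auto simp: T_def)
  have \<D>E: "\<exists>a b. (X, a, b) \<in> \<C> \<and> a \<le> a' \<and> a' \<le> b' \<and> b' \<le> b \<and> a' = Min (T X a b) \<and> b' = Max (T X a b)
      \<and> a' \<in> T X a b \<and> b' \<in> T X a b" if "(X, a', b') \<in> \<D>" for X a' b'
  proof -
    from that obtain a b x y where *: "(X, a, b) \<in> \<C>" "a \<le> b" "x \<in> X" "y \<in> X" "x \<noteq> y"
      "a' = Min (T X a b)" "b' = Max (T X a b)" unfolding \<D>_def by blast
    obtain t where "({x, y}, t) \<in> time_edges G" "a \<le> t" "t \<le> b"
      using time_near[OF re *(1,3-5), of a] *(2) by auto
    then have t: "t \<in> T X a b" using * unfolding T_def by auto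
    then have T: "a' \<in> T X a b" "b' \<in> T X a b"
      using Min_in[OF fin, of X a b] Max_in[OF fin, of X a b] *(6,7) by auto
    have "a' \<le> t" "t \<le> b'" using fin t *(6,7) by auto
    then have "a' \<le> b'" by linarith
    moreover have "a \<le> a'" "b' \<le> b" using T unfolding T_def by auto
    ultimately show ?thesis using * T by blast
  qed
  have "pre_realises \<Delta>1 \<Delta>2 G \<D>"
  proof (rule pre_realisesI)
    fix X a' b' Y c' d' v s t
    assume "(X, a', b') \<in> \<D>" "(Y, c', d') \<in> \<D>"
      and *: "v \<in> X" "v \<in> Y" "a' \<le> s" "s \<le> b'" "c' \<le> t" "t \<le> d'" "\<bar>s - t\<bar> < \<Delta>2"
    then obtain a b c d where "(X, a, b) \<in> \<C>" "a \<le> a'" "b' \<le> b" "a' = Min (T X a b)" "b' = Max (T X a b)"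
      "(Y, c, d) \<in> \<C>" "c \<le> c'" "d' \<le> d" "c' = Min (T Y c d)" "d' = Max (T Y c d)"
      using \<D>E[of X a' b'] \<D>E[of Y c' d'] by blast
    then show "X = Y \<and> a' = c' \<and> b' = d'"
      using pre_realises_unique[OF re, of X a b Y c d v s t] * by simp
  next
    fix e t assume e: "(e, t) \<in> time_edges G"
    then obtain X a b where X: "(X, a, b) \<in> \<C>" "e \<subseteq> X" "a \<le> t" "t \<le> b"
      using pre_realises_cover[OF re] by metis
    obtain x y where "e = {x, y}" "x \<noteq> y"
      using time_edgeD(5)[OF G e] by (meson card_2_iff)
    then have t: "t \<in> T X a b" and x: "\<exists>x\<in>X. \<exists>y\<in>X. x \<noteq> y" using X e unfolding T_def by auto
    have "Min (T X a b) \<le> t" "t \<le> Max (T X a b)" using fin t by auto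
    moreover have "a \<le> b" using X by linarith
    then have "(X, Min (T X a b), Max (T X a b)) \<in> \<D>"
      using X x unfolding \<D>_def by blast
    ultimately
    show "\<exists>X a b. (X, a, b) \<in> \<D> \<and> e \<subseteq> X \<and> a \<le> t \<and> t \<le> b" using X(2) by blast
  next
    fix X a' b' x y
    assume X': "(X, a', b') \<in> \<D>" and x: "x \<in> X" "y \<in> X" "x \<noteq> y"
    obtain a b where X: "(X, a, b) \<in> \<C>" "a \<le> a'" "a' \<le> b'" "b' \<le> b"
      and ab': "a' = Min (T X a b)" "b' = Max (T X a b)" using \<D>E[OF X'] by blast
    note c = pre_realises_clique[OF re X(1) x]
    have "\<exists>t\<in>times G {x, y}. \<tau> \<le> t \<and> t \<le> \<tau> + \<Delta>1 - 1" if \<tau>: "\<tau> \<in> {a'..max a' (b' - \<Delta>1 + 1)}" for \<tau>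
    \<comment> \<open>If the shrunk interval has at least \<open>\<Delta>1\<close> elements, its
      windows are also windows of the original one. Otherwise its only window starts at
      \<open>a'\<close> and contains the whole shrunk interval, hence every time that
      \<open>{x, y}\<close> has between \<open>a\<close> and \<open>b\<close>.\<close>
    proof (cases "a' \<le> b' - \<Delta>1 + 1")
      case True
      then have "\<tau> \<in> {a..max a (b - \<Delta>1 + 1)}" using \<tau> X by auto
      then show ?thesis using c(2) unfolding dense_def by blast
    next
      case False
      then have [simp]: "\<tau> = a'" using \<tau> by auto
      obtain t where t: "({x, y}, t) \<in> time_edges G" "a \<le> t" "t \<le> b"
        using time_near[OF re X(1) x, of a] X by auto
      then have "t \<in> T X a b" using x unfolding T_def by auto
      then have "a' \<le> t" "t \<le> b'" using fin ab' by auto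
      then show ?thesis using t(1) False unfolding time_edges_def by (intro bexI[of _ t]) auto
    qed
    then show "{x, y} \<in> edges G \<and> dense \<Delta>1 G {x, y} a' b'"
      using c(1) unfolding dense_def by blast
  qed
  moreover have "X \<subseteq> verts G \<and> 1 \<le> a' \<and> a' \<le> b' \<and> b' \<le> lifetime G" if X': "(X, a', b') \<in> \<D>" for X a' b'
  proof -
    obtain a b where X: "(X, a, b) \<in> \<C>" "a' \<le> b'"
      and ab': "a' \<in> T X a b" "b' \<in> T X a b" using \<D>E[OF X'] by blast
    have "x \<in> verts G" if x: "x \<in> X" for x
    proof -
      obtain y where "y \<in> X" "x \<noteq> y" using X' x unfolding \<D>_def by auto
      then have "{x, y} \<in> edges G" using pre_realises_clique(1)[OF re X(1)] x by blast
      then show ?thesis using G by (auto simp: temporal_graph_def)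
    qed
    then show ?thesis using ab' X(2) time_edgeD(3)[OF G] le_lifetime[OF G] unfolding T_def by blast
  qed
  ultimately have "realises \<Delta>1 \<Delta>2 G \<D>"
    unfolding realises_iff_pre_realises by simp
  then show ?thesis unfolding cluster_temporal_graph_def by blast
qed

lemma cluster_iff_pre_realises:
  "temporal_graph G \<Longrightarrow> cluster_temporal_graph \<Delta>1 \<Delta>2 G \<longleftrightarrow> (\<exists>\<C>. pre_realises \<Delta>1 \<Delta>2 G \<C>)"
  using pre_realises_imp_cluster realises_iff_pre_realises
  unfolding cluster_temporal_graph_def by metis

lemma cluster_induced:
  assumes "temporal_graph G" "cluster_temporal_graph \<Delta>1 \<Delta>2 G" "S \<subseteq> verts G"
  shows "cluster_temporal_graph \<Delta>1 \<Delta>2 (induced G S)"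
  using assms pre_realises_induced temporal_graph_induced cluster_iff_pre_realises by metis

section \<open>Chains of links inside a single template\<close>

text \<open>Induction on the gap. If it is at least \<open>\<Delta>2\<close>, the window from
  \<open>t + 1\<close> to \<open>t + \<Delta>1\<close> fits into the interval and contains a time
  \<open>u\<close> of \<open>e\<close>; since \<open>\<Delta>1 < \<Delta>2\<close>, this
  \<open>u\<close> is linked to \<open>t\<close> and still comes before \<open>s\<close>.\<close>

lemma link_rtrancl_dense:
  assumes "dense \<Delta>1 G e a b" "(e, t) \<in> time_edges G" "(e, s) \<in> time_edges G" "e \<noteq> {}"
    and "a \<le> t" "t \<le> s" "s \<le> b"
  shows "((e, t), (e, s)) \<in> (link \<Delta>2 G)\<^sup>*"
  using assms(2,5,6)
proof (induction "nat (s - t)" arbitrary: t rule: less_induct)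
  case less
  show ?case
  proof (cases "s - t < \<Delta>2")
    case True
    then show ?thesis using less.prems assms by (intro r_into_rtrancl) (auto simp: link_def)
  next
    case False
    then have "t + 1 \<in> {a..max a (b - \<Delta>1 + 1)}" using less.prems assms \<Delta>2_gt by auto
    then obtain u where u: "u \<in> times G e" "t + 1 \<le> u" "u \<le> t + \<Delta>1"
      using assms(1) unfolding dense_def by fastforce
    then have ue: "(e, u) \<in> time_edges G" using assms(2) by (auto simp: time_edges_def)
    then have "((e, t), (e, u)) \<in> link \<Delta>2 G"
      using less.prems assms u \<Delta>2_gt by (auto simp: link_def)
    moreover have "((e, u), (e, s)) \<in> (link \<Delta>2 G)\<^sup>*"
      using less.hyps[of u] u ue less.prems False \<Delta>2_gt by auto
    ultimately show ?thesis by (rule converse_rtrancl_into_rtrancl)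
  qed
qed

lemma link_rtrancl_dense':
  assumes "dense \<Delta>1 G e a b" "(e, t) \<in> time_edges G" "(e, s) \<in> time_edges G" "e \<noteq> {}"
    and "t \<in> {a..b}" "s \<in> {a..b}"
  shows "((e, t), (e, s)) \<in> (link \<Delta>2 G)\<^sup>*"
  using link_rtrancl_dense[of G e a b t s] link_rtrancl_dense[of G e a b s t] assms
    link_rtrancl_sym[of "(e, s)" "(e, t)" \<Delta>2 G] by (metis atLeastAtMost_iff linorder_linear)

text \<open>\<open>time_near\<close> gives \<open>e\<close> a time \<open>u\<close> less than
  \<open>\<Delta>1\<close> away from \<open>s\<close>. Density leads from \<open>t\<close> to
  \<open>u\<close> along \<open>e\<close> alone, and the last link passes to \<open>f\<close>
  because \<open>\<Delta>1 < \<Delta>2\<close>. The set \<open>A\<close> leaves room for further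
  vertices, as the case of disjoint edges requires.\<close>

lemma link_rtrancl_template_meeting:
  assumes G: "temporal_graph G" and re: "pre_realises \<Delta>1 \<Delta>2 G \<C>" and X: "(X, a, b) \<in> \<C>"
    and e: "(e, t) \<in> time_edges G" "e \<subseteq> X" "t \<in> {a..b}"
    and f: "(f, s) \<in> time_edges G" "f \<subseteq> X" "s \<in> {a..b}"
    and ef: "e \<inter> f \<noteq> {}" "e \<union> f \<subseteq> A"
  shows "((e, t), (f, s)) \<in> (link \<Delta>2 (induced G A))\<^sup>*"
proof -
  obtain x y where xy: "e = {x, y}" "x \<noteq> y"
    using time_edgeD(5)[OF G e(1)] by (meson card_2_iff)
  then obtain u where u: "(e, u) \<in> time_edges G" "a \<le> u" "u \<le> b" "\<bar>u - s\<bar> < \<Delta>1"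
    using time_near[OF re X, of x y s] e f by auto
  have "((e, t), (e, u)) \<in> (link \<Delta>2 (induced G A))\<^sup>*"
    using pre_realises_clique(2)[OF re X, of x y] xy e u ef
    by (intro link_rtrancl_dense'[of _ _ a b]) (auto simp: time_edges_induced)
  moreover have "((e, u), (f, s)) \<in> link \<Delta>2 (induced G A)"
    using u f ef \<Delta>2_gt unfolding link_def time_edges_induced by auto
  ultimately show ?thesis by (rule rtrancl_into_rtrancl)
qed

text \<open>Converse of \<open>link_rtrancl_same_template\<close>, with the chain confined to the
  endpoints of the two edges. Disjoint edges are joined through a clique edge \<open>{x, z}\<close>
  between them.\<close>

lemma link_rtrancl_template:
  assumes G: "temporal_graph G" and re: "pre_realises \<Delta>1 \<Delta>2 G \<C>" and X: "(X, a, b) \<in> \<C>"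
    and e: "(e, t) \<in> time_edges G" "e \<subseteq> X" "t \<in> {a..b}"
    and f: "(f, s) \<in> time_edges G" "f \<subseteq> X" "s \<in> {a..b}"
  shows "((e, t), (f, s)) \<in> (link \<Delta>2 (induced G (e \<union> f)))\<^sup>*"
proof (cases "e \<inter> f = {}")
  case False
  from link_rtrancl_template_meeting[OF assms this order_refl] show ?thesis .
next
  case True
  have "e \<noteq> {}" "f \<noteq> {}"
    using time_edgeD(5)[OF G e(1)] time_edgeD(5)[OF G f(1)] by auto
  then obtain x z where x: "x \<in> e" "z \<in> f" "x \<noteq> z" using True by blast
  have xX: "x \<in> X" "z \<in> X" and t: "a \<le> t" "t \<le> b" using x e f by auto
  obtain u where u: "({x, z}, u) \<in> time_edges G" "a \<le> u" "u \<le> b"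
    using time_near[OF re X xX x(3) t] by metis
  have "((e, t), ({x, z}, u)) \<in> (link \<Delta>2 (induced G (e \<union> f)))\<^sup>*"
    using x e f u by (intro link_rtrancl_template_meeting[OF G re X]) auto
  moreover have "(({x, z}, u), (f, s)) \<in> (link \<Delta>2 (induced G (e \<union> f)))\<^sup>*"
    using x e f u by (intro link_rtrancl_template_meeting[OF G re X]) auto
  ultimately show ?thesis by (rule rtrancl_trans)
qed

end

section \<open>Linked time-edges under the five-vertex condition\<close>

locale locally_cluster = density_bounds +
  fixes G :: "'a temporal_graph"
  assumes G: "temporal_graph G"
    and local_cluster: "S \<subseteq> verts G \<Longrightarrow> card S \<le> 5 \<Longrightarrow> cluster_temporal_graph \<Delta>1 \<Delta>2 (induced G S)"
begin

abbreviation linked :: "'a set \<times> int \<Rightarrow> 'a set \<times> int \<Rightarrow> bool" (infix "\<approx>" 50) where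
  "p \<approx> q \<equiv> (p, q) \<in> (link \<Delta>2 G)\<^sup>*"

lemma local_realisation:
  assumes "S \<subseteq> verts G" "card S \<le> 5"
  obtains \<C> where "pre_realises \<Delta>1 \<Delta>2 (induced G S) \<C>"
  using local_cluster[OF assms] realises_iff_pre_realises that
  unfolding cluster_temporal_graph_def by metis

text \<open>Induction along the chain. In a realisation on \<open>e \<union> f \<union> g\<close>
  the extended chain stays in one template, and \<open>link_rtrancl_template\<close> then reconnects
  its two ends inside \<open>e \<union> g\<close>, discarding the other vertices of
  \<open>f\<close>.\<close>

lemma linked_locally:
  assumes "(e, t) \<approx> (f, s)" "(e, t) \<in> time_edges G"
  shows "((e, t), (f, s)) \<in> (link \<Delta>2 (induced G (e \<union> f)))\<^sup>*"
  using assms(1)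
proof (induction "f" "s" rule: rtrancl_induct2)
  case refl
  show ?case by simp
next
  case (step f s g r)
  have fg: "(f, s) \<in> time_edges G" "(g, r) \<in> time_edges G" "f \<inter> g \<noteq> {}" "\<bar>s - r\<bar> < \<Delta>2"
    using step.hyps(2) by (auto simp: link_def)
  define S where "S = e \<union> f \<union> g"
  note E = time_edgeD(4,5)[OF G]
  have SV: "S \<subseteq> verts G" using assms(2) fg E unfolding S_def by blast
  have *: "finite f" "finite g" "card e = 2" "card f = 2" "card g = 2"
    using assms(2) fg E by (auto intro: card_ge_0_finite)
  \<comment> \<open>Origin of the bound five: \<open>f\<close> and \<open>g\<close> meet and span at
    most three vertices, and \<open>e\<close> adds at most two.\<close>
  then have "card (f \<inter> g) > 0" using fg(3) by (simp add: card_gt_0_iff)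
  then have "card (f \<union> g) \<le> 3" using card_Un_Int[of f g] * by simp
  then have "card S \<le> 5"
    using card_Un_le[of e "f \<union> g"] * unfolding S_def by (simp add: Un_assoc)
  then obtain \<D> where \<D>: "pre_realises \<Delta>1 \<Delta>2 (induced G S) \<D>"
    using local_realisation SV by metis
  have te: "(e, t) \<in> time_edges (induced G S)" "(g, r) \<in> time_edges (induced G S)"
    using assms(2) fg by (auto simp: time_edges_induced S_def)
  obtain X a b where X: "(X, a, b) \<in> \<D>" "e \<subseteq> X" "a \<le> t" "t \<le> b"
    using pre_realises_cover[OF \<D> te(1)] by metis
  have "((e, t), (f, s)) \<in> (link \<Delta>2 (induced G S))\<^sup>*"
    using step.IH rtrancl_mono[OF link_mono[of "e \<union> f" S]] unfolding S_def by blast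
  moreover have "((f, s), (g, r)) \<in> link \<Delta>2 (induced G S)"
    using fg by (auto simp: link_def time_edges_induced S_def)
  ultimately have "((e, t), (g, r)) \<in> (link \<Delta>2 (induced G S))\<^sup>*" by (rule rtrancl_into_rtrancl)
  from link_rtrancl_same_template[OF \<D> X(1) this X(2-4)]
  have "g \<subseteq> X" "a \<le> r" "r \<le> b" by auto
  then have "((e, t), (g, r)) \<in> (link \<Delta>2 (induced (induced G S) (e \<union> g)))\<^sup>*"
    using link_rtrancl_template[OF temporal_graph_induced[OF G SV] \<D> X(1) te(1) X(2) _ te(2)] X by auto
  moreover have "e \<union> g \<subseteq> S" unfolding S_def by auto
  ultimately show ?case by (simp add: induced_induced)
qed

text \<open>\<open>linked_locally\<close> confines the chain to \<open>S\<close>, where it cannot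
  leave the template that covers \<open>(e, t)\<close>.\<close>

lemma linked_same_template:
  assumes "(e, t) \<approx> (f, s)" "(e, t) \<in> time_edges G" "e \<union> f \<subseteq> S"
    and "pre_realises \<Delta>1 \<Delta>2 (induced G S) \<C>"
  obtains X a b where "(X, a, b) \<in> \<C>" "e \<subseteq> X" "f \<subseteq> X" "a \<le> t" "t \<le> b" "a \<le> s" "s \<le> b"
proof -
  have "(e, t) \<in> time_edges (induced G S)" using assms by (auto simp: time_edges_induced)
  then obtain X a b where X: "(X, a, b) \<in> \<C>" "e \<subseteq> X" "a \<le> t" "t \<le> b"
    using pre_realises_cover[OF assms(4)] by metis
  have "((e, t), (f, s)) \<in> (link \<Delta>2 (induced G S))\<^sup>*"
    using linked_locally[OF assms(1,2)] rtrancl_mono[OF link_mono[OF assms(3)]] by blast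
  from link_rtrancl_same_template[OF assms(4) X(1) this X(2-4)] show thesis
    using that[OF X(1,2) _ X(3,4)] by simp
qed

text \<open>Only the at most four vertices of \<open>e \<union> f\<close> are involved. A
  realisation there has one template containing both time-edges, whose interval contains every
  \<open>r\<close> between their times, and \<open>time_near\<close> in that template yields
  \<open>u\<close>.\<close>

lemma linked_near:
  assumes "(e, t) \<approx> (f, s)" "(e, t) \<in> time_edges G" "x \<in> e \<union> f" "y \<in> e \<union> f" "x \<noteq> y"
    and r: "min t s \<le> r" "r \<le> max t s"
  obtains u where "({x, y}, u) \<in> time_edges G" "(e, t) \<approx> ({x, y}, u)" "\<bar>u - r\<bar> < \<Delta>1"
proof -
  have f: "(f, s) \<in> time_edges G" using assms link_rtrancl_time_edge by metis
  have SV: "e \<union> f \<subseteq> verts G" using assms f time_edgeD(4)[OF G] by blast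
  have "card (e \<union> f) \<le> 5"
    using card_Un_le[of e f] time_edgeD(5)[OF G assms(2)] time_edgeD(5)[OF G f] by simp
  then obtain \<D> where \<D>: "pre_realises \<Delta>1 \<Delta>2 (induced G (e \<union> f)) \<D>"
    using local_realisation SV by metis
  obtain X a b where X: "(X, a, b) \<in> \<D>" "e \<subseteq> X" "f \<subseteq> X" "a \<le> t" "t \<le> b" "a \<le> s" "s \<le> b"
    using linked_same_template[OF assms(1,2) order_refl \<D>] by metis
  have xy: "x \<in> X" "y \<in> X" using assms X by auto
  have ar: "a \<le> r" "r \<le> b" using r X by linarith+
  obtain u where u: "({x, y}, u) \<in> time_edges (induced G (e \<union> f))" "a \<le> u" "u \<le> b" "\<bar>u - r\<bar> < \<Delta>1"
    using time_near[OF \<D> X(1) xy assms(5) ar] by metis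
  have "((e, t), ({x, y}, u)) \<in> (link \<Delta>2 (induced (induced G (e \<union> f)) (e \<union> {x, y})))\<^sup>*"
    using assms u X link_rtrancl_template[OF temporal_graph_induced[OF G SV] \<D> X(1), of e t "{x, y}" u]
    by (auto simp: time_edges_induced)
  then have "(e, t) \<approx> ({x, y}, u)"
    using rtrancl_mono[OF link_induced_le] by blast
  then show thesis using that u by (auto simp: time_edges_induced)
qed

text \<open>In a realisation on the two vertices of \<open>e\<close>, both times belong to one
  template, and its density covers every window between them.\<close>

lemma linked_dense:
  assumes "(e, t) \<approx> (e, s)" "(e, t) \<in> time_edges G" "t \<le> \<tau>" "\<tau> + \<Delta>1 - 1 \<le> s"
  shows "\<exists>u\<in>times G e. \<tau> \<le> u \<and> u \<le> \<tau> + \<Delta>1 - 1"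
proof -
  have e: "e \<subseteq> verts G" "card e = 2" using time_edgeD[OF G assms(2)] by auto
  then obtain \<D> where \<D>: "pre_realises \<Delta>1 \<Delta>2 (induced G e) \<D>"
    using local_realisation[of e] by auto
  obtain X a b where X: "(X, a, b) \<in> \<D>" "e \<subseteq> X" "a \<le> t" "s \<le> b"
    by (rule linked_same_template[OF assms(1,2) _ \<D>]) auto
  moreover obtain x y where "e = {x, y}" "x \<noteq> y" using e(2) by (meson card_2_iff)
  ultimately have "dense \<Delta>1 G e a b" using pre_realises_clique(2)[OF \<D> X(1), of x y] by simp
  moreover have "\<tau> \<in> {a..max a (b - \<Delta>1 + 1)}" using X assms by auto
  ultimately show ?thesis unfolding dense_def by blast
qed

text \<open>Two classes with a common vertex \<open>v\<close> are compared inside \<open>h \<union> k \<union> {v}\<close>, which again has at most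
  five vertices.\<close>

lemma linked_if_close:
  assumes h: "(h, t) \<in> time_edges G" "(h, t) \<approx> (e, t')" "v \<in> e"
    and k: "(k, r) \<in> time_edges G" "(k, r) \<approx> (f, r')" "v \<in> f" and d: "\<bar>t - r\<bar> < \<Delta>2"
  shows "(h, t) \<approx> (k, r)"
proof -
  define S where "S = insert v (h \<union> k)"
  have v: "v \<in> verts G" using link_rtrancl_time_edge[OF h(2,1)] time_edgeD(4)[OF G] h(3) by blast
  have SV: "S \<subseteq> verts G" using h k v time_edgeD(4)[OF G] unfolding S_def by blast
  have "finite (h \<union> k)"
    using time_edgeD(5)[OF G h(1)] time_edgeD(5)[OF G k(1)] by (auto intro: card_ge_0_finite)
  then have "card S \<le> 5"
    using card_Un_le[of h k] time_edgeD(5)[OF G h(1)] time_edgeD(5)[OF G k(1)]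
      card_insert_le_m1[of 5 "h \<union> k" v] unfolding S_def by simp
  then obtain \<D> where \<D>: "pre_realises \<Delta>1 \<Delta>2 (induced G S) \<D>"
    using local_realisation SV by metis
  \<comment> \<open>The time-edge of the class at \<open>v\<close> may leave \<open>S\<close>. By
    \<open>linked_near\<close> it can be exchanged for one on \<open>{w, v}\<close> with
    \<open>w\<close> in \<open>h\<close>, which stays inside \<open>S\<close>, so the template
    covering \<open>(h, t)\<close> contains \<open>v\<close>.\<close>
  have *: "\<exists>X a b. (X, a, b) \<in> \<D> \<and> h \<subseteq> X \<and> v \<in> X \<and> a \<le> t \<and> t \<le> b"
    if h: "(h, t) \<in> time_edges G" "(h, t) \<approx> (e, t')" "v \<in> e" "h \<subseteq> S" for h t e t'
  proof -
    obtain w where w: "w \<in> h" "w \<noteq> v"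
      using time_edgeD(5)[OF G h(1)] by (metis card_2_iff insertI1 insertI2)
    then obtain u where u: "({w, v}, u) \<in> time_edges G" "(h, t) \<approx> ({w, v}, u)"
      using linked_near[OF h(2,1), of w v t] h(3) by auto
    have "h \<union> {w, v} \<subseteq> S" using w h(4) unfolding S_def by auto
    from linked_same_template[OF u(2) h(1) this \<D>] show ?thesis by (metis insert_subset)
  qed
  obtain X a b where X: "(X, a, b) \<in> \<D>" "h \<subseteq> X" "v \<in> X" "a \<le> t" "t \<le> b"
    using *[OF h] unfolding S_def by auto
  obtain Y a' b' where Y: "(Y, a', b') \<in> \<D>" "k \<subseteq> Y" "v \<in> Y" "a' \<le> r" "r \<le> b'"
    using *[OF k] unfolding S_def by auto
  have "X = Y" "a = a'" "b = b'"
    using pre_realises_unique[OF \<D> X(1) Y(1) X(3) Y(3) X(4,5) Y(4,5) d] by auto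
  then have "((h, t), (k, r)) \<in> (link \<Delta>2 (induced (induced G S) (h \<union> k)))\<^sup>*"
    using X Y h k link_rtrancl_template[OF temporal_graph_induced[OF G SV] \<D> X(1), of h t k r]
    by (auto simp: time_edges_induced S_def)
  then show ?thesis using rtrancl_mono[OF link_induced_le] by blast
qed

section \<open>Equivalence classes as templates\<close>

definition cls :: "'a set \<times> int \<Rightarrow> ('a set \<times> int) set" where
  "cls p = (link \<Delta>2 G)\<^sup>* `` {p}"

definition class_template :: "'a set \<times> int \<Rightarrow> 'a template" where
  "class_template p = (\<Union> (fst ` cls p), Min (snd ` cls p), Max (snd ` cls p))"

lemma cls_subset: "p \<in> time_edges G \<Longrightarrow> cls p \<subseteq> time_edges G"
  using link_rtrancl_time_edge unfolding cls_def by blast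

lemma
  assumes "class_template p = (X, a, b)" "p \<in> time_edges G"
  shows linked_in_class_template: "p \<approx> (e, t) \<Longrightarrow> e \<subseteq> X \<and> a \<le> t \<and> t \<le> b"
    and class_template_vertex: "v \<in> X \<Longrightarrow> \<exists>e t. p \<approx> (e, t) \<and> v \<in> e"
    and class_template_start: "\<exists>e. p \<approx> (e, a)"
    and class_template_end: "\<exists>e. p \<approx> (e, b)"
proof -
  have fin: "finite (snd ` cls p)"
    using finite_subset[OF cls_subset[OF assms(2)] finite_time_edges[OF G]] by simp
  have ab: "X = \<Union> (fst ` cls p)" "a = Min (snd ` cls p)" "b = Max (snd ` cls p)"
    using assms(1) by (auto simp: class_template_def)
  have "snd ` cls p \<noteq> {}" unfolding cls_def by auto
  then have "a \<in> snd ` cls p" "b \<in> snd ` cls p" using ab(2,3) Min_in[OF fin] Max_in[OF fin] by auto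
  then show "\<exists>e. p \<approx> (e, a)" "\<exists>e. p \<approx> (e, b)" unfolding cls_def by auto
  show "e \<subseteq> X \<and> a \<le> t \<and> t \<le> b" if "p \<approx> (e, t)"
  proof -
    have c: "(e, t) \<in> cls p" using that unfolding cls_def by simp
    then have t: "t \<in> snd ` cls p" by force
    from c have "e \<subseteq> X" unfolding ab(1) by force
    then show ?thesis using Min_le[OF fin t] Max_ge[OF fin t] ab by simp
  qed
  show "\<exists>e t. p \<approx> (e, t) \<and> v \<in> e" if "v \<in> X"
    using that unfolding ab(1) cls_def by auto
qed

lemma linked_sym: "p \<approx> q \<Longrightarrow> q \<approx> p"
  by (rule link_rtrancl_sym)

lemma class_template_eq:
  assumes "p \<approx> q"
  shows "class_template p = class_template q"
proof -
  have "cls p = cls q"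
    using rtrancl_trans[OF assms] rtrancl_trans[OF linked_sym[OF assms]] unfolding cls_def by blast
  then show ?thesis unfolding class_template_def by simp
qed

text \<open>Two applications of \<open>linked_near\<close>: the first finds some time-edge of the
  class on \<open>{x, y}\<close>, the second moves it close to \<open>s\<close>.\<close>

lemma class_template_clique:
  assumes p: "class_template p = (X, a, b)" "p \<in> time_edges G" and x: "x \<in> X" "y \<in> X" "x \<noteq> y"
    and s: "p \<approx> (f, s)"
  obtains u where "({x, y}, u) \<in> time_edges G" "p \<approx> ({x, y}, u)" "\<bar>u - s\<bar> < \<Delta>1"
proof -
  have te: "q \<in> time_edges G" if "p \<approx> q" for q using link_rtrancl_time_edge that p(2) by metis
  obtain e t e' t' where e: "p \<approx> (e, t)" "x \<in> e" and e': "p \<approx> (e', t')" "y \<in> e'"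
    using class_template_vertex[OF p x(1)] class_template_vertex[OF p x(2)] by metis
  have "(e, t) \<approx> (e', t')" using e e' linked_sym rtrancl_trans by metis
  then obtain u where u: "({x, y}, u) \<in> time_edges G" "(e, t) \<approx> ({x, y}, u)"
    using linked_near[of e t e' t' x y t] te[OF e(1)] e(2) e'(2) x(3)
    by (metis UnI1 UnI2 min.cobounded1 max.cobounded1)
  then have pu: "p \<approx> ({x, y}, u)" using e rtrancl_trans by metis
  then have "({x, y}, u) \<approx> (f, s)" using s linked_sym rtrancl_trans by metis
  then obtain u' where "({x, y}, u') \<in> time_edges G" "({x, y}, u) \<approx> ({x, y}, u')" "\<bar>u' - s\<bar> < \<Delta>1"
    using linked_near[of "{x, y}" u f s x y s] u x by auto
  then show thesis using that pu rtrancl_trans by metis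
qed

text \<open>The edge \<open>{x, y}\<close> has times \<open>t\<close> and \<open>s\<close> of the
  class less than \<open>\<Delta>1\<close> away from \<open>a\<close> and \<open>b\<close>. A window
  that is not strictly between \<open>t\<close> and \<open>s\<close> contains one of them; the
  others are covered by \<open>linked_dense\<close>.\<close>

lemma class_template_dense:
  assumes p: "class_template p = (X, a, b)" "p \<in> time_edges G" and x: "x \<in> X" "y \<in> X" "x \<noteq> y"
  shows "dense \<Delta>1 G {x, y} a b"
  unfolding dense_def
proof
  fix \<tau> assume \<tau>: "\<tau> \<in> {a..max a (b - \<Delta>1 + 1)}"
  obtain f g where f: "p \<approx> (f, a)" and g: "p \<approx> (g, b)"
    using class_template_start[OF p] class_template_end[OF p] by metis
  have ab: "a \<le> t \<and> t \<le> b" if "p \<approx> (e, t)" for e t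
    using linked_in_class_template[OF p that] by simp
  obtain t where t: "({x, y}, t) \<in> time_edges G" "p \<approx> ({x, y}, t)" "\<bar>t - a\<bar> < \<Delta>1"
    using class_template_clique[OF p x f] by metis
  obtain s where s: "({x, y}, s) \<in> time_edges G" "p \<approx> ({x, y}, s)" "\<bar>s - b\<bar> < \<Delta>1"
    using class_template_clique[OF p x g] by metis
  have ts: "t \<in> times G {x, y}" "s \<in> times G {x, y}" using t s by (auto simp: time_edges_def)
  have bd: "a \<le> t" "t \<le> b" "a \<le> s" "s \<le> b" using ab t s by auto
  consider "\<tau> \<le> t" | "t < \<tau>" "s \<le> \<tau> + \<Delta>1 - 1" | "t < \<tau>" "\<tau> + \<Delta>1 - 1 < s" by linarith
  then show "\<exists>t\<in>times G {x, y}. \<tau> \<le> t \<and> t \<le> \<tau> + \<Delta>1 - 1"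
  proof cases
    case 1
    then show ?thesis using ts(1) t(3) \<tau> by (intro bexI[of _ t]) auto
  next
    case 2
    then show ?thesis using ts(2) s(3) \<tau> bd by (intro bexI[of _ s]) auto
  next
    case 3
    have "({x, y}, t) \<approx> ({x, y}, s)" using t s linked_sym rtrancl_trans by metis
    then show ?thesis using linked_dense[OF _ t(1)] 3 by simp
  qed
qed

text \<open>A class has no long gaps: \<open>linked_near\<close> applies to a time-edge at the start
  and one at the end of its span, and the edge at the start already has times of the class close to
  every \<open>s\<close> in between.\<close>

lemma class_template_near:
  assumes p: "class_template p = (X, a, b)" "p \<in> time_edges G" and s: "a \<le> s" "s \<le> b"
  obtains e t where "p \<approx> (e, t)" "\<bar>t - s\<bar> < \<Delta>1"
proof -
  obtain f g where f: "p \<approx> (f, a)" and g: "p \<approx> (g, b)"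
    using class_template_start[OF p] class_template_end[OF p] by metis
  have te: "(f, a) \<in> time_edges G" using link_rtrancl_time_edge f p(2) by metis
  then obtain x y where xy: "f = {x, y}" "x \<noteq> y"
    using time_edgeD(5)[OF G] by (meson card_2_iff)
  have "(f, a) \<approx> (g, b)" using f g linked_sym rtrancl_trans by metis
  then obtain u where "(f, a) \<approx> (f, u)" "\<bar>u - s\<bar> < \<Delta>1"
    using linked_near[of f a g b x y s] te xy s by auto
  then show thesis using that f rtrancl_trans by metis
qed

text \<open>The times \<open>s\<close> and \<open>t\<close> are only known to lie in the spans of
  the classes. They are first replaced by times of actual time-edges of the two classes that are
  less than \<open>\<Delta>2\<close> apart; then \<open>linked_if_close\<close> applies at
  \<open>v\<close>.\<close>

lemma class_template_unique:
  assumes p: "class_template p = (X, a, b)" "p \<in> time_edges G"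
    and q: "class_template q = (Y, c, d)" "q \<in> time_edges G"
    and v: "v \<in> X" "v \<in> Y"
    and st: "a \<le> s" "s \<le> b" "c \<le> t" "t \<le> d" "\<bar>s - t\<bar> < \<Delta>2"
  shows "p \<approx> q"
proof -
  have "\<exists>e. p \<approx> (e, a)" "\<exists>e. p \<approx> (e, b)" "\<exists>e. q \<approx> (e, c)" "\<exists>e. q \<approx> (e, d)"
    using class_template_start[OF p] class_template_end[OF p]
      class_template_start[OF q] class_template_end[OF q] by auto
  then obtain ea eb ec ed where e: "p \<approx> (ea, a)" "p \<approx> (eb, b)" "q \<approx> (ec, c)" "q \<approx> (ed, d)" by blast
  \<comment> \<open>For disjoint spans, the two facing ends are at most as far apart as
    \<open>s\<close> and \<open>t\<close>. If the spans overlap, the start of one lies in the span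
    of the other, which has a time less than \<open>\<Delta>1\<close> away from it.\<close>
  consider "b < c" | "d < a" | "a \<le> c" "c \<le> b" | "c \<le> a" "a \<le> d" by linarith
  then have "\<exists>h u k r. p \<approx> (h, u) \<and> q \<approx> (k, r) \<and> \<bar>u - r\<bar> < \<Delta>2"
  proof cases
    case 1
    then have "\<bar>b - c\<bar> < \<Delta>2" using st by linarith
    then show ?thesis using e by blast
  next
    case 2
    then have "\<bar>a - d\<bar> < \<Delta>2" using st by linarith
    then show ?thesis using e by blast
  next
    case 3
    then obtain h u where "p \<approx> (h, u)" "\<bar>u - c\<bar> < \<Delta>1" using class_template_near[OF p] by metis
    moreover from this have "\<bar>u - c\<bar> < \<Delta>2" using \<Delta>2_gt by linarith
    ultimately show ?thesis using e by blast
  next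
    case 4
    then obtain k u where "q \<approx> (k, u)" "\<bar>u - a\<bar> < \<Delta>1" using class_template_near[OF q] by metis
    moreover from this have "\<bar>a - u\<bar> < \<Delta>2" using \<Delta>2_gt by linarith
    ultimately show ?thesis using e by blast
  qed
  then obtain h u k r where h: "p \<approx> (h, u)" and k: "q \<approx> (k, r)" and ur: "\<bar>u - r\<bar> < \<Delta>2" by blast
  obtain e t' f r' where ef: "p \<approx> (e, t')" "v \<in> e" "q \<approx> (f, r')" "v \<in> f"
    using class_template_vertex[OF p v(1)] class_template_vertex[OF q v(2)] by metis
  have "(h, u) \<in> time_edges G" "(k, r) \<in> time_edges G"
    using link_rtrancl_time_edge[OF h p(2)] link_rtrancl_time_edge[OF k q(2)] by auto
  moreover have "(h, u) \<approx> (e, t')" "(k, r) \<approx> (f, r')"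
    using h k ef linked_sym rtrancl_trans by metis+
  ultimately have "(h, u) \<approx> (k, r)" using linked_if_close ef ur by metis
  then show ?thesis using h k linked_sym rtrancl_trans by metis
qed

lemma cluster: "cluster_temporal_graph \<Delta>1 \<Delta>2 G"
proof -
  have "pre_realises \<Delta>1 \<Delta>2 G (class_template ` time_edges G)"
  proof (rule pre_realisesI)
    fix X a b Y c d v s t
    assume "(X, a, b) \<in> class_template ` time_edges G" "(Y, c, d) \<in> class_template ` time_edges G"
      and *: "v \<in> X" "v \<in> Y" "a \<le> s" "s \<le> b" "c \<le> t" "t \<le> d" "\<bar>s - t\<bar> < \<Delta>2"
    then obtain p q where p: "class_template p = (X, a, b)" "p \<in> time_edges G"
      and q: "class_template q = (Y, c, d)" "q \<in> time_edges G" by fastforce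
    show "X = Y \<and> a = c \<and> b = d"
      using class_template_eq[OF class_template_unique[OF p q *]] p q by simp
  next
    fix e t assume e: "(e, t) \<in> time_edges G"
    obtain X a b where X: "class_template (e, t) = (X, a, b)" using prod_cases3 by blast
    then have "e \<subseteq> X \<and> a \<le> t \<and> t \<le> b" using linked_in_class_template[OF X e] by blast
    then show "\<exists>X a b. (X, a, b) \<in> class_template ` time_edges G \<and> e \<subseteq> X \<and> a \<le> t \<and> t \<le> b"
      using X e by (metis image_eqI)
  next
    fix X a b x y
    assume "(X, a, b) \<in> class_template ` time_edges G" and x: "x \<in> X" "y \<in> X" "x \<noteq> y"
    then obtain p where p: "class_template p = (X, a, b)" "p \<in> time_edges G" by fastforce
    obtain f where "p \<approx> (f, a)" using class_template_start[OF p] by metis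
    then obtain u where "({x, y}, u) \<in> time_edges G" using class_template_clique[OF p x] by metis
    then show "{x, y} \<in> edges G \<and> dense \<Delta>1 G {x, y} a b"
      using class_template_dense[OF p x] time_edgeD(1)[OF G] by blast
  qed
  then show ?thesis using pre_realises_imp_cluster[OF G] by blast
qed

end

section \<open>Maximal runs of times, for \<open>\<Delta>1 = 1\<close>\<close>

definition run :: "'a temporal_graph \<Rightarrow> 'a set \<Rightarrow> int \<Rightarrow> int \<Rightarrow> bool" where
  "run G e a b \<longleftrightarrow> e \<in> edges G \<and> a \<le> b \<and> {a..b} \<subseteq> times G e \<and> a - 1 \<notin> times G e \<and> b + 1 \<notin> times G e"

lemma dense_one_iff: "a \<le> b \<Longrightarrow> dense 1 G e a b \<longleftrightarrow> {a..b} \<subseteq> times G e"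
  by (force simp: dense_def)

lemma run_unique:
  assumes "run G e a b" "run G e c d" "a \<le> s" "s \<le> b" "c \<le> s" "s \<le> d"
  shows "a = c \<and> b = d"
proof -
  have "c \<le> a" if "run G e a b" "run G e c d" "a \<le> s" "s \<le> b" "c \<le> s" "s \<le> d" for a b c d
  proof (rule ccontr)
    assume "\<not> c \<le> a"
    then have "c - 1 \<in> {a..b}" using that by auto
    then show False using that unfolding run_def by blast
  qed
  moreover have "b \<le> d" if "run G e a b" "run G e c d" "a \<le> s" "s \<le> b" "c \<le> s" "s \<le> d" for a b c d
  proof (rule ccontr)
    assume "\<not> b \<le> d"
    then have "d + 1 \<in> {a..b}" using that by auto
    then show False using that unfolding run_def by blast
  qed
  ultimately show ?thesis using assms by (meson order_antisym)
qed

locale triple_cluster = density_bounds 1 \<Delta>2 for \<Delta>2 +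
  fixes G :: "'a temporal_graph"
  assumes G: "temporal_graph G"
    and local_cluster: "S \<subseteq> verts G \<Longrightarrow> card S \<le> 3 \<Longrightarrow> cluster_temporal_graph 1 \<Delta>2 (induced G S)"
begin

lemma local_realisation:
  assumes "S \<subseteq> verts G" "card S \<le> 3"
  obtains \<C> where "pre_realises 1 \<Delta>2 (induced G S) \<C>"
  using local_cluster[OF assms] realises_iff_pre_realises that
  unfolding cluster_temporal_graph_def by metis

text \<open>For maximality: if the edge were present at \<open>a - 1\<close> or
  \<open>b + 1\<close>, the template covering that time-edge would be too close in time to be
  independent of \<open>(X, a, b)\<close>, hence equal to it, although its interval is not.\<close>

lemma run_template:
  assumes re: "pre_realises 1 \<Delta>2 (induced G S) \<C>" and X: "(X, a, b) \<in> \<C>"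
    and x: "x \<in> X" "y \<in> X" "x \<noteq> y" and "a \<le> b"
  shows "run G {x, y} a b"
proof -
  note c = pre_realises_clique[OF re X x]
  have ab: "{a..b} \<subseteq> times G {x, y}" using c(2) \<open>a \<le> b\<close> by (simp add: dense_one_iff)
  have "a \<le> t \<and> t \<le> b" if t: "t \<in> times G {x, y}" "a - 1 \<le> t" "t \<le> b + 1" for t
  proof -
    have "({x, y}, t) \<in> time_edges (induced G S)"
      using c(1) t(1) by (auto simp: time_edges_induced) (auto simp: time_edges_def)
    then obtain Y c d where Y: "(Y, c, d) \<in> \<C>" "{x, y} \<subseteq> Y" "c \<le> t" "t \<le> d"
      using pre_realises_cover[OF re] by metis
    \<comment> \<open>\<open>s\<close> is the time between \<open>a\<close> and \<open>b\<close>
      nearest to \<open>t\<close>, at distance at most 1, which is less than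
      \<open>\<Delta>2\<close>.\<close>
    define s where "s = max a (min t b)"
    have "a \<le> s" "s \<le> b" "\<bar>s - t\<bar> < \<Delta>2" using t \<open>a \<le> b\<close> \<Delta>2_gt unfolding s_def by linarith+
    then show ?thesis
      using pre_realises_unique(2,3)[OF re X Y(1), of x s t] x Y by auto
  qed
  from this[of "a - 1"] this[of "b + 1"] show ?thesis
    using c(1) ab \<open>a \<le> b\<close> unfolding run_def by auto
qed

lemma run_exists:
  assumes "(e, t) \<in> time_edges G"
  obtains a b where "run G e a b" "a \<le> t" "t \<le> b"
proof -
  note e = time_edgeD[OF G assms]
  obtain \<D> where \<D>: "pre_realises 1 \<Delta>2 (induced G e) \<D>"
    using local_realisation[of e] e by auto
  have "(e, t) \<in> time_edges (induced G e)" using assms by (simp add: time_edges_induced)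
  then obtain X a b where X: "(X, a, b) \<in> \<D>" "e \<subseteq> X" "a \<le> t" "t \<le> b"
    using pre_realises_cover[OF \<D>] by metis
  obtain x y where "e = {x, y}" "x \<noteq> y" using e(5) by (meson card_2_iff)
  then show thesis using that run_template[OF \<D> X(1), of x y] X by auto
qed

lemma run_time_edge: "run G e a b \<Longrightarrow> a \<le> s \<Longrightarrow> s \<le> b \<Longrightarrow> (e, s) \<in> time_edges G"
  unfolding run_def time_edges_def by auto

lemma run_neq: "run G {x, y} a b \<Longrightarrow> x \<noteq> y"
  using G unfolding run_def temporal_graph_def by fastforce

text \<open>In a realisation on \<open>{v, x, y}\<close>, both time-edges lie in one template by
  independence. Its interval is a run of every edge inside it, so \<open>run_unique\<close>
  identifies it with both given runs.\<close>

lemma runs_at_vertex: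
  assumes r: "run G {v, x} a b" "run G {v, y} c d"
    and st: "a \<le> s" "s \<le> b" "c \<le> t" "t \<le> d" "\<bar>s - t\<bar> < \<Delta>2"
  shows "a = c" "b = d" "x \<noteq> y \<Longrightarrow> run G {x, y} a b"
proof -
  define S where "S = {v, x, y}"
  have "S \<subseteq> verts G"
    using time_edgeD(4)[OF G run_time_edge[OF r(1) st(1,2)]]
      time_edgeD(4)[OF G run_time_edge[OF r(2) st(3,4)]] unfolding S_def by simp
  moreover have "card S \<le> 3" unfolding S_def by (simp add: card_insert_if)
  ultimately obtain \<D> where \<D>: "pre_realises 1 \<Delta>2 (induced G S) \<D>"
    using local_realisation by metis
  have "({v, x}, s) \<in> time_edges (induced G S)" "({v, y}, t) \<in> time_edges (induced G S)"
    using run_time_edge[OF r(1) st(1,2)] run_time_edge[OF r(2) st(3,4)]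
    by (auto simp: time_edges_induced S_def)
  then obtain X a' b' Y c' d' where X: "(X, a', b') \<in> \<D>" "{v, x} \<subseteq> X" "a' \<le> s" "s \<le> b'"
    and Y: "(Y, c', d') \<in> \<D>" "{v, y} \<subseteq> Y" "c' \<le> t" "t \<le> d'"
    using pre_realises_cover[OF \<D>] by metis
  have eq: "X = Y" "a' = c'" "b' = d'"
    using pre_realises_unique[OF \<D> X(1) Y(1), of v s t] X Y st by auto
  have "v \<noteq> x" "v \<noteq> y" using r run_neq by auto
  then have r': "run G {v, x} a' b'" "run G {v, y} a' b'"
    using run_template[OF \<D> X(1)] X Y eq by auto
  have "a = a' \<and> b = b'" using run_unique[OF r(1) r'(1) st(1,2) X(3,4)] .
  moreover have "c = a' \<and> d = b'" using run_unique[OF r(2) r'(2) st(3,4)] Y(3,4) eq by simp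
  ultimately show "a = c" "b = d" "x \<noteq> y \<Longrightarrow> run G {x, y} a b"
    using run_template[OF \<D> X(1), of x y] X Y eq by auto
qed

text \<open>\<open>x\<close> is inserted by hand because \<open>{x, x}\<close> is a singleton and
  never an edge.\<close>

definition same_run :: "'a \<Rightarrow> int \<Rightarrow> int \<Rightarrow> 'a set" where
  "same_run x a b = insert x {v. run G {x, v} a b}"

text \<open>Transitivity of having a common run, from \<open>runs_at_vertex\<close> at the middle
  vertex \<open>v\<close>.\<close>

lemma same_run_subset:
  assumes "v \<in> same_run x a b"
  shows "same_run v a b \<subseteq> same_run x a b"
proof
  fix z assume z: "z \<in> same_run v a b"
  show "z \<in> same_run x a b"
  proof (cases "v = x \<or> z = v \<or> z = x")
    case True
    then show ?thesis using z assms unfolding same_run_def by auto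
  next
    case False
    then have "run G {v, x} a b" "run G {v, z} a b" "x \<noteq> z"
      using z assms unfolding same_run_def by (auto simp: insert_commute)
    moreover have "a \<le> b" "\<bar>a - a\<bar> < \<Delta>2" using \<open>run G {v, x} a b\<close> \<Delta>2_gt unfolding run_def by auto
    ultimately have "run G {x, z} a b" using runs_at_vertex(3)[of v x a b z a b a a] by auto
    then show ?thesis unfolding same_run_def by simp
  qed
qed

lemma same_run_eq:
  assumes "v \<in> same_run x a b"
  shows "same_run v a b = same_run x a b"
proof -
  have "x \<in> same_run v a b" using assms unfolding same_run_def by (auto simp: insert_commute)
  then show ?thesis using same_run_subset assms by blast
qed

lemma cluster: "cluster_temporal_graph 1 \<Delta>2 G"
proof -
  \<comment> \<open>Requiring a run at \<open>x\<close> excludes singletons \<open>{x}\<close> with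
    arbitrary intervals, which would violate independence.\<close>
  define \<C> where "\<C> = {(same_run x a b, a, b) | x a b. \<exists>w. run G {x, w} a b}"
  have run_at: "\<exists>w. run G {v, w} a b" if "run G {x, w} a b" "v \<in> same_run x a b" for v x w a b
    using that unfolding same_run_def by (auto simp: insert_commute)
  have "pre_realises 1 \<Delta>2 G \<C>"
  proof (rule pre_realisesI)
    fix X a b Y c d v s t
    assume "(X, a, b) \<in> \<C>" "(Y, c, d) \<in> \<C>"
      and *: "v \<in> X" "v \<in> Y" "a \<le> s" "s \<le> b" "c \<le> t" "t \<le> d" "\<bar>s - t\<bar> < \<Delta>2"
    then obtain x y w w' where X: "X = same_run x a b" "run G {x, w} a b"
      and Y: "Y = same_run y c d" "run G {y, w'} c d" unfolding \<C>_def by auto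
    obtain u u' where "run G {v, u} a b" "run G {v, u'} c d"
      using run_at X Y *(1,2) by metis
    then have "a = c" "b = d" using runs_at_vertex(1,2) *(3-) by metis+
    then show "X = Y \<and> a = c \<and> b = d" using same_run_eq X Y *(1,2) by metis
  next
    fix e t assume e: "(e, t) \<in> time_edges G"
    obtain a b where ab: "run G e a b" "a \<le> t" "t \<le> b" using run_exists[OF e] .
    obtain x y where xy: "e = {x, y}" using time_edgeD(5)[OF G e] by (meson card_2_iff)
    then have "(same_run x a b, a, b) \<in> \<C>" "e \<subseteq> same_run x a b"
      using ab unfolding \<C>_def same_run_def by auto
    then show "\<exists>X a b. (X, a, b) \<in> \<C> \<and> e \<subseteq> X \<and> a \<le> t \<and> t \<le> b" using ab by blast
  next
    fix X a b y z
    assume "(X, a, b) \<in> \<C>" and yz: "y \<in> X" "z \<in> X" "y \<noteq> z"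
    then obtain x where "X = same_run x a b" unfolding \<C>_def by auto
    then have "z \<in> same_run y a b" using same_run_eq yz by metis
    then have "run G {y, z} a b" using yz unfolding same_run_def by auto
    then show "{y, z} \<in> edges G \<and> dense 1 G {y, z} a b"
      by (simp add: run_def dense_one_iff)
  qed
  then show ?thesis using pre_realises_imp_cluster[OF G] by blast
qed

end

text \<open>Necessity is \<open>cluster_induced\<close> in both parts, for sets \<open>S\<close> of
  any size. As \<open>verts G\<close> is finite, no infinite \<open>S\<close> enters through the
  default cardinality 0.\<close>

theorem theorem4:
  fixes \<Delta>1 \<Delta>2 :: int and G :: "'a temporal_graph"
  assumes "temporal_graph G" and "\<Delta>1 \<ge> 1" and "\<Delta>2 > \<Delta>1"
  shows "(\<Delta>1 = 1 \<longrightarrow>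
            (cluster_temporal_graph 1 \<Delta>2 G \<longleftrightarrow>
              (\<forall>S. S \<subseteq> verts G \<and> card S \<le> 3 \<longrightarrow>
                 cluster_temporal_graph 1 \<Delta>2 (induced G S)))) \<and>
         (\<Delta>1 > 1 \<longrightarrow>
            (cluster_temporal_graph \<Delta>1 \<Delta>2 G \<longleftrightarrow>
              (\<forall>S. S \<subseteq> verts G \<and> card S \<le> 5 \<longrightarrow>
                 cluster_temporal_graph \<Delta>1 \<Delta>2 (induced G S))))"
proof (intro conjI impI)
  interpret density_bounds \<Delta>1 \<Delta>2 by unfold_locales (use assms in auto)
  show "cluster_temporal_graph 1 \<Delta>2 G \<longleftrightarrow>
      (\<forall>S. S \<subseteq> verts G \<and> card S \<le> 3 \<longrightarrow> cluster_temporal_graph 1 \<Delta>2 (induced G S))" if "\<Delta>1 = 1"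
  proof
    assume "cluster_temporal_graph 1 \<Delta>2 G"
    then show "\<forall>S. S \<subseteq> verts G \<and> card S \<le> 3 \<longrightarrow> cluster_temporal_graph 1 \<Delta>2 (induced G S)"
      using cluster_induced[OF assms(1)] that by simp
  next
    assume "\<forall>S. S \<subseteq> verts G \<and> card S \<le> 3 \<longrightarrow> cluster_temporal_graph 1 \<Delta>2 (induced G S)"
    then interpret triple_cluster \<Delta>2 G by unfold_locales (use assms that in auto)
    show "cluster_temporal_graph 1 \<Delta>2 G" by (rule cluster)
  qed
  show "cluster_temporal_graph \<Delta>1 \<Delta>2 G \<longleftrightarrow>
      (\<forall>S. S \<subseteq> verts G \<and> card S \<le> 5 \<longrightarrow> cluster_temporal_graph \<Delta>1 \<Delta>2 (induced G S))"
  proof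
    assume "cluster_temporal_graph \<Delta>1 \<Delta>2 G"
    then show "\<forall>S. S \<subseteq> verts G \<and> card S \<le> 5 \<longrightarrow> cluster_temporal_graph \<Delta>1 \<Delta>2 (induced G S)"
      using cluster_induced[OF assms(1)] by simp
  next
    assume "\<forall>S. S \<subseteq> verts G \<and> card S \<le> 5 \<longrightarrow> cluster_temporal_graph \<Delta>1 \<Delta>2 (induced G S)"
    then interpret locally_cluster \<Delta>1 \<Delta>2 G by unfold_locales (use assms in auto)
    show "cluster_temporal_graph \<Delta>1 \<Delta>2 G" by (rule cluster)
  qed
qed

end
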